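(* Let $d\ge2$ be an integer and let $T_{d,d}\in\mathbb{R}[x,y]_d$ be the homogeneous polynomial $$T_{d,d}(x,y)=\sum_{k=0}^{\lfloor d/2\rfloor}(-1)^k\binom{d}{2k}y^{2k}x^{d-2k},$$ i.e. the one with $T_{d,d}(\cos\theta,\sin\theta)=\cos(d\theta)$ for all $\theta$. Then $T_{d,d}$ is a local maximum of the distance to the discriminant, $P\mapsto\mathrm{dist}(P,\Delta)$, among the polynomials of $\mathbb{R}[x,y]_d$ with the same Bombieri norm as $T_{d,d}$.
   Context: $\mathbb{R}[x,y]_d$ is the space of real homogeneous polynomials of degree $d$ in two variables, with the Bombieri norm: the norm of the scalar product for which distinct monomials are orthogonal and $\|x^iy^{d-i}\|^2=i!(d-i)!/d!$. The real discriminant $\Delta$ is the set of $Q\in\mathbb{R}[x,y]_d$ for which there is a point $u$ of the unit circle with $Q(u)=0$ and $\nabla Q(u)=0$; $\mathrm{dist}(P,\Delta)=\inf_{Q\in\Delta}\|P-Q\|$ for the Bombieri norm. *)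

theory Defs
  imports "HOL-Analysis.Analysis" "HOL-Computational_Algebra.Polynomial"
begin

text \<open>
  A bivariate polynomial is a polynomial in $y$ whose coefficients are polynomials in $x$:
  the outer variable of \<^typ>\<open>real poly poly\<close> is $y$, the inner one is $x$.
\<close>

definition coeff2 :: "real poly poly \<Rightarrow> nat \<Rightarrow> nat \<Rightarrow> real"
  \<comment> \<open>the coefficient of $x^i y^j$\<close>
  where "coeff2 P i j = coeff (coeff P j) i"

definition eval2 :: "real poly poly \<Rightarrow> real \<times> real \<Rightarrow> real"
  where "eval2 P u = poly (poly P [:snd u:]) (fst u)"

definition forms :: "nat \<Rightarrow> real poly poly set"
  \<comment> \<open>$\mathbb{R}[x,y]_d$, including the zero polynomial\<close>
  where "forms d = {P. \<forall>i j. coeff2 P i j \<noteq> 0 \<longrightarrow> i + j = d}"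

definition bombieri_inner :: "nat \<Rightarrow> real poly poly \<Rightarrow> real poly poly \<Rightarrow> real"
  where "bombieri_inner d P Q =
    (\<Sum>i\<le>d. (fact i * fact (d - i) / fact d) * (coeff2 P i (d - i) * coeff2 Q i (d - i)))"

definition bombieri_norm :: "nat \<Rightarrow> real poly poly \<Rightarrow> real"
  where "bombieri_norm d P = sqrt (bombieri_inner d P P)"

definition real_discriminant :: "nat \<Rightarrow> real poly poly set"
  where "real_discriminant d =
    {Q \<in> forms d. \<exists>u. norm u = 1 \<and> eval2 Q u = 0 \<and> (GDERIV (eval2 Q) u :> 0)}"

definition dist_discriminant :: "nat \<Rightarrow> real poly poly \<Rightarrow> real"
  where "dist_discriminant d P = (INF Q\<in>real_discriminant d. bombieri_norm d (P - Q))"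

definition T_form :: "nat \<Rightarrow> real poly poly"
  where "T_form d =
    (\<Sum>k\<le>d div 2. monom (monom ((-1) ^ k * real (d choose (2 * k))) (d - 2 * k)) (2 * k))"

lemma T_form_in_forms: "T_form d \<in> forms d"
proof -
  have "i + j = d" if "coeff2 (T_form d) i j \<noteq> 0" for i j
  proof (rule ccontr)
    assume "i + j \<noteq> d"
    then have "coeff2 (T_form d) i j = 0"
      unfolding coeff2_def T_form_def coeff_sum
      by (intro sum.neutral) (auto simp: coeff_monom)
    with that show False by simp
  qed
  then show ?thesis by (auto simp: forms_def)
qed

lemma eval2_T_form:
  "eval2 (T_form d) (x, y) =
    (\<Sum>k\<le>d div 2. (-1) ^ k * real (d choose (2 * k)) * y ^ (2 * k) * x ^ (d - 2 * k))"
  by (simp add: eval2_def T_form_def poly_sum poly_monom poly_power mult_ac)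

lemma eval2_T_form_circle: "eval2 (T_form d) (cos t, sin t) = cos (real d * t)"
proof -
  have pw: "Re ((\<i> * complex_of_real s) ^ j) = (if even j then (-1) ^ (j div 2) * s ^ j else 0)"
    for s j
  proof (cases "even j")
    case True
    then obtain m where "j = 2 * m" by blast
    then have "(\<i> * complex_of_real s) ^ j = complex_of_real ((-1) ^ m * s ^ j)"
      by (simp add: power_mult_distrib power_mult power_minus[of "(complex_of_real s)\<^sup>2"])
    with \<open>j = 2 * m\<close> show ?thesis by simp
  next
    case False
    then obtain m where "j = 2 * m + 1" by (blast elim: oddE)
    then have "(\<i> * complex_of_real s) ^ j = \<i> * complex_of_real ((-1) ^ m * s ^ j)"
      by (simp add: power_mult_distrib power_mult power_minus[of "(complex_of_real s)\<^sup>2"])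
    with False show ?thesis by simp
  qed
  define g where
    "g j = real (d choose j) * (if even j then (-1) ^ (j div 2) * sin t ^ j else 0) * cos t ^ (d - j)"
    for j
  have "cos (real d * t) = Re (cis t ^ d)"
    by (metis Complex.DeMoivre cis.sel(1))
  also have "cis t = \<i> * complex_of_real (sin t) + complex_of_real (cos t)"
    by (simp add: complex_eq_iff)
  also have "Re ((\<i> * complex_of_real (sin t) + complex_of_real (cos t)) ^ d) = (\<Sum>j\<le>d. g j)"
    unfolding binomial_ring Re_sum
  proof (intro sum.cong refl)
    fix j
    have "of_nat (d choose j) * (\<i> * complex_of_real (sin t)) ^ j * complex_of_real (cos t) ^ (d - j)
      = complex_of_real (real (d choose j) * cos t ^ (d - j)) * (\<i> * complex_of_real (sin t)) ^ j"
      by (simp add: mult_ac)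
    also have "Re \<dots> = real (d choose j) * cos t ^ (d - j) * Re ((\<i> * complex_of_real (sin t)) ^ j)"
      by (simp only: times_complex.sel Re_complex_of_real Im_complex_of_real mult_zero_left diff_zero)
    finally show "Re (of_nat (d choose j) * (\<i> * complex_of_real (sin t)) ^ j
        * complex_of_real (cos t) ^ (d - j)) = g j"
      by (simp add: g_def pw mult_ac)
  qed
  also have "\<dots> = (\<Sum>j\<in>(\<lambda>k. 2 * k) ` {..d div 2}. g j)"
  proof (rule sum.mono_neutral_right)
    show "\<forall>j\<in>{..d} - (\<lambda>k. 2 * k) ` {..d div 2}. g j = 0"
      by (auto simp: g_def image_iff elim!: evenE)
  qed auto
  also have "\<dots> = (\<Sum>k\<le>d div 2. g (2 * k))"
    by (subst sum.reindex) (auto simp: inj_on_def)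
  also have "\<dots> = eval2 (T_form d) (cos t, sin t)"
    by (simp add: eval2_T_form g_def mult_ac)
  finally show ?thesis ..
qed

end

theory Submission
  imports Defs
begin

text \<open>
  Write $f(t) = P(\cos t, \sin t)$. The squared distance from $P$ to the forms with a double root at
  $(\cos t, \sin t)$ is $f(t)^2 + f'(t)^2/d$, so it suffices to find $t$ where this is at most $1$,
  its minimum for $T = T_{d,d}$. Let $T_\varphi$ be the rotation of $T$ nearest to $P$ and
  $h = P - T_\varphi$. If $f^2 + f'^2/d > 1$ at all extremal points $t_k = \varphi + k\pi/d$ of
  $T_\varphi$, then $(-1)^k h(t_k) > -\|h\|^2/2$ by Bessel's inequality. Because
  $\sum_k (-1)^k h(t_k)$ is a positive multiple of $\langle h, T_\varphi\rangle = -\|h\|^2/2$, every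
  $h(t_k)$ is $O(\|h\|^2)$. As $h$ is orthogonal to the tangent of the rotation orbit
  at $T_\varphi$, it is controlled linearly by these values (discrete Fourier transform), whence
  $\|h\| = O(\|h\|^2)$, impossible for small $h \ne 0$; and $h = 0$ contradicts the strict inequality.
\<close>

section \<open>Coefficient vectors and reproducing kernels on the circle\<close>

text \<open>The Bombieri product on coefficient sequences indexed by the power of x: the weight
  i!(d-i)!/d! is the reciprocal of a binomial coefficient. Entries beyond \<open>d\<close> are
  ignored.\<close>

definition coeff_inner :: "nat \<Rightarrow> (nat \<Rightarrow> real) \<Rightarrow> (nat \<Rightarrow> real) \<Rightarrow> real"
  where "coeff_inner d a b = (\<Sum>i\<le>d. a i * b i / real (d choose i))"

definition circle_val :: "nat \<Rightarrow> (nat \<Rightarrow> real) \<Rightarrow> real \<Rightarrow> real"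
  where "circle_val d a t = (\<Sum>i\<le>d. a i * (cos t ^ i * sin t ^ (d - i)))"

text \<open>The derivative of cos^i t sin^(d-i) t in t. Where subtraction truncates an exponent, the
  factor in front is 0.\<close>

definition monom_deriv :: "nat \<Rightarrow> nat \<Rightarrow> real \<Rightarrow> real"
  where "monom_deriv d i t = cos t * (real (d - i) * (cos t ^ i * sin t ^ (d - i - 1)))
    - sin t * (real i * (cos t ^ (i - 1) * sin t ^ (d - i)))"

definition circle_deriv :: "nat \<Rightarrow> (nat \<Rightarrow> real) \<Rightarrow> real \<Rightarrow> real"
  where "circle_deriv d a t = (\<Sum>i\<le>d. a i * monom_deriv d i t)"

text \<open>The coefficients of (x cos t + y sin t)^d, the reproducing kernel of evaluation at (cos
  t, sin t): the binomial factor cancels the weight in \<open>coeff_inner\<close>.\<close>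

definition point_kernel :: "nat \<Rightarrow> real \<Rightarrow> nat \<Rightarrow> real"
  where "point_kernel d t i = real (d choose i) * (cos t ^ i * sin t ^ (d - i))"

text \<open>The derivative of \<open>point_kernel\<close> in t; it represents differentiation along
  the circle.\<close>

definition tangent_kernel :: "nat \<Rightarrow> real \<Rightarrow> nat \<Rightarrow> real"
  where "tangent_kernel d t i = real (d choose i) * monom_deriv d i t"

lemma coeff_inner_commute: "coeff_inner d a b = coeff_inner d b a"
  by (simp add: coeff_inner_def mult.commute)

lemma coeff_inner_diff_left:
  "coeff_inner d (\<lambda>i. a i - b i) c = coeff_inner d a c - coeff_inner d b c"
  by (simp add: coeff_inner_def left_diff_distrib diff_divide_distrib sum_subtractf)

lemma coeff_inner_add_left:
  "coeff_inner d (\<lambda>i. a i + b i) c = coeff_inner d a c + coeff_inner d b c"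
  by (simp add: coeff_inner_def distrib_right add_divide_distrib sum.distrib)

lemma coeff_inner_scale_left:
  "coeff_inner d (\<lambda>i. s * a i) c = s * coeff_inner d a c"
  by (simp add: coeff_inner_def sum_distrib_left mult.assoc)

lemma coeff_inner_diff_right:
  "coeff_inner d c (\<lambda>i. a i - b i) = coeff_inner d c a - coeff_inner d c b"
  by (metis coeff_inner_commute coeff_inner_diff_left)

lemma coeff_inner_add_right:
  "coeff_inner d c (\<lambda>i. a i + b i) = coeff_inner d c a + coeff_inner d c b"
  by (metis coeff_inner_commute coeff_inner_add_left)

lemma coeff_inner_scale_right:
  "coeff_inner d c (\<lambda>i. s * a i) = s * coeff_inner d c a"
  by (metis coeff_inner_commute coeff_inner_scale_left)

lemmas coeff_inner_linear =
  coeff_inner_diff_left coeff_inner_add_left coeff_inner_scale_left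
  coeff_inner_diff_right coeff_inner_add_right coeff_inner_scale_right

lemma coeff_inner_nonneg: "coeff_inner d a a \<ge> 0"
  by (auto simp: coeff_inner_def intro!: sum_nonneg divide_nonneg_nonneg)

lemma coeff_inner_point_kernel: "coeff_inner d a (point_kernel d t) = circle_val d a t"
  unfolding coeff_inner_def point_kernel_def circle_val_def by (intro sum.cong) auto

lemma coeff_inner_tangent_kernel: "coeff_inner d a (tangent_kernel d t) = circle_deriv d a t"
  unfolding coeff_inner_def tangent_kernel_def circle_deriv_def by (intro sum.cong) auto

lemma circle_val_has_derivative:
  "(circle_val d a has_real_derivative circle_deriv d a t) (at t)"
proof -
  have "((\<lambda>t. \<Sum>i\<le>d. a i * (cos t ^ i * sin t ^ (d - i))) has_real_derivative
      (\<Sum>i\<le>d. a i * monom_deriv d i t)) (at t)"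
    unfolding monom_deriv_def
    by (intro DERIV_sum) (auto intro!: derivative_eq_intros simp: algebra_simps)
  then show ?thesis
    by (simp add: circle_val_def[abs_def] circle_deriv_def)
qed

text \<open>The kernel is the \<open>d\<close>-th power of a linear form whose value at angle s is
  cos (s - t), so the binomial theorem sums it.\<close>

lemma circle_val_point_kernel: "circle_val d (point_kernel d t) s = cos (s - t) ^ d"
proof -
  have "cos (s - t) ^ d = (cos t * cos s + sin t * sin s) ^ d"
    by (simp add: cos_diff mult.commute)
  then show ?thesis
    unfolding circle_val_def point_kernel_def binomial_ring
    by (simp add: power_mult_distrib mult_ac)
qed

lemma circle_deriv_point_kernel:
  "circle_deriv d (point_kernel d t) s = - real d * cos (s - t) ^ (d - 1) * sin (s - t)"
proof (rule DERIV_unique[OF circle_val_has_derivative])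
  show "(circle_val d (point_kernel d t) has_real_derivative
      - real d * cos (s - t) ^ (d - 1) * sin (s - t)) (at s)"
    unfolding circle_val_point_kernel[abs_def] by (auto intro!: derivative_eq_intros)
qed

text \<open>By symmetry of the product, evaluating the tangent kernel of t at s is differentiating
  the point kernel of s at t.\<close>

lemma circle_val_tangent_kernel: "circle_val d (tangent_kernel d t) s = real d * cos (s - t) ^ (d - 1) * sin (s - t)"
proof -
  have "circle_val d (tangent_kernel d t) s = circle_deriv d (point_kernel d s) t"
    by (metis coeff_inner_commute coeff_inner_point_kernel coeff_inner_tangent_kernel)
  then show ?thesis
    by (simp add: circle_deriv_point_kernel cos_diff sin_diff algebra_simps)
qed

lemma circle_deriv_tangent_kernel_self: "circle_deriv d (tangent_kernel d t) t = real d"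
proof (rule DERIV_unique[OF circle_val_has_derivative])
  show "(circle_val d (tangent_kernel d t) has_real_derivative real d) (at t)"
    unfolding circle_val_tangent_kernel[abs_def] by (auto intro!: derivative_eq_intros)
qed

section \<open>Projection onto the forms with a double root at a given point\<close>

text \<open>
  The functions \<^const>\<open>point_kernel\<close> and \<^const>\<open>tangent_kernel\<close> represent evaluation and
  tangential derivative at a point, are orthogonal and have squared norms $1$ and $d$.
  So subtracting the projection onto their span is the nearest way to create a double root there.
\<close>

definition residual :: "nat \<Rightarrow> (nat \<Rightarrow> real) \<Rightarrow> real \<Rightarrow> nat \<Rightarrow> real"
  where "residual d a t i =
    a i - (circle_val d a t * point_kernel d t i + circle_deriv d a t / real d * tangent_kernel d t i)"

lemma kernel_gram:
  "coeff_inner d (point_kernel d t) (point_kernel d t) = 1"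
  "coeff_inner d (point_kernel d t) (tangent_kernel d t) = 0"
  "coeff_inner d (tangent_kernel d t) (point_kernel d t) = 0"
  "coeff_inner d (tangent_kernel d t) (tangent_kernel d t) = real d"
  by (simp_all add: coeff_inner_point_kernel coeff_inner_tangent_kernel circle_val_point_kernel circle_val_tangent_kernel
      circle_deriv_point_kernel circle_deriv_tangent_kernel_self)

lemma circle_val_residual: "circle_val d (residual d a t) t = 0"
  unfolding coeff_inner_point_kernel[symmetric] residual_def[abs_def] coeff_inner_linear kernel_gram
  by simp

lemma circle_deriv_residual: "d > 0 \<Longrightarrow> circle_deriv d (residual d a t) t = 0"
  unfolding coeff_inner_tangent_kernel[symmetric] residual_def[abs_def] coeff_inner_linear kernel_gram
  by simp

text \<open>Pythagoras in the span of the two orthogonal kernels; this is the squared cost of the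
  double root that \<open>residual\<close> creates.\<close>

lemma coeff_inner_projection:
  assumes "d > 0"
  shows "coeff_inner d (\<lambda>i. a i - residual d a t i) (\<lambda>i. a i - residual d a t i)
    = (circle_val d a t)\<^sup>2 + (circle_deriv d a t)\<^sup>2 / real d"
proof -
  have "(\<lambda>i. a i - residual d a t i) =
      (\<lambda>i. circle_val d a t * point_kernel d t i + circle_deriv d a t / real d * tangent_kernel d t i)"
    by (simp add: residual_def)
  then show ?thesis
    using assms by (simp only: coeff_inner_linear kernel_gram) (simp add: power2_eq_square)
qed

text \<open>The norm of \<open>residual\<close> is nonnegative. The inequality serves twice: it
  bounds distances to the discriminant from below, and it controls the quadratic terms of a small
  perturbation.\<close>

lemma bessel:
  assumes "d > 0"
  shows "(circle_val d a t)\<^sup>2 + (circle_deriv d a t)\<^sup>2 / real d \<le> coeff_inner d a a"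
proof -
  have "0 \<le> coeff_inner d (residual d a t) (residual d a t)"
    by (rule coeff_inner_nonneg)
  also have "\<dots> = coeff_inner d a a - ((circle_val d a t)\<^sup>2 + (circle_deriv d a t)\<^sup>2 / real d)"
    using assms
    unfolding residual_def[abs_def] coeff_inner_linear kernel_gram
      coeff_inner_commute[of d "point_kernel d t" a] coeff_inner_commute[of d "tangent_kernel d t" a]
    unfolding coeff_inner_point_kernel coeff_inner_tangent_kernel
    by (simp add: power2_eq_square)
  finally show ?thesis by simp
qed

section \<open>Forms as coefficient vectors, and the distance to the discriminant\<close>

definition form_coeff :: "nat \<Rightarrow> real poly poly \<Rightarrow> nat \<Rightarrow> real"
  where "form_coeff d P i = coeff2 P i (d - i)"

definition form_of :: "nat \<Rightarrow> (nat \<Rightarrow> real) \<Rightarrow> real poly poly"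
  where "form_of d a = (\<Sum>i\<le>d. monom (monom (a i) i) (d - i))"

lemma form_of_in_forms: "form_of d a \<in> forms d"
proof -
  have "coeff2 (form_of d a) i j = 0" if "i + j \<noteq> d" for i j
    unfolding coeff2_def form_of_def coeff_sum
    using that by (intro sum.neutral) (auto simp: coeff_monom)
  then show ?thesis by (auto simp: forms_def)
qed

lemma form_coeff_form_of: "i \<le> d \<Longrightarrow> form_coeff d (form_of d a) i = a i"
proof -
  assume i: "i \<le> d"
  have "form_coeff d (form_of d a) i = (\<Sum>j\<le>d. if j = i then a j else 0)"
    unfolding form_coeff_def coeff2_def form_of_def coeff_sum
    using i by (intro sum.cong) (auto simp: coeff_monom)
  with i show ?thesis by simp
qed

lemma form_of_form_coeff:
  assumes "P \<in> forms d"
  shows "form_of d (form_coeff d P) = P"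
proof (intro poly_eqI)
  fix j i
  show "coeff (coeff (form_of d (form_coeff d P)) j) i = coeff (coeff P j) i"
  proof (cases "i + j = d")
    case True
    then have "j = d - i" "i \<le> d" by auto
    with form_coeff_form_of[of i d "form_coeff d P"] show ?thesis
      by (simp add: form_coeff_def coeff2_def)
  next
    case False
    then show ?thesis
      using assms form_of_in_forms[of d "form_coeff d P"] unfolding forms_def coeff2_def by force
  qed
qed

lemma eval2_form_of:
  "eval2 (form_of d a) u = (\<Sum>i\<le>d. a i * (fst u ^ i * snd u ^ (d - i)))"
  by (simp add: eval2_def form_of_def poly_sum poly_monom poly_power mult_ac)

lemma eval2_form:
  "P \<in> forms d \<Longrightarrow> eval2 P u = (\<Sum>i\<le>d. form_coeff d P i * (fst u ^ i * snd u ^ (d - i)))"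
  using eval2_form_of[of d "form_coeff d P" u] by (simp add: form_of_form_coeff)

lemma eval2_circle: "P \<in> forms d \<Longrightarrow> eval2 P (cos t, sin t) = circle_val d (form_coeff d P) t"
  by (simp add: eval2_form circle_val_def)

lemma form_coeff_diff: "form_coeff d (P - Q) = (\<lambda>i. form_coeff d P i - form_coeff d Q i)"
  by (simp add: form_coeff_def coeff2_def fun_eq_iff)

lemma bombieri_norm_eq: "bombieri_norm d P = sqrt (coeff_inner d (form_coeff d P) (form_coeff d P))"
proof -
  have "bombieri_inner d P P = coeff_inner d (form_coeff d P) (form_coeff d P)"
    unfolding bombieri_inner_def coeff_inner_def form_coeff_def
    by (intro sum.cong) (auto simp: binomial_fact)
  then show ?thesis by (simp add: bombieri_norm_def)
qed

text \<open>The chain rule along the parametrised circle.\<close>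

lemma form_coeff_double_root:
  assumes P: "P \<in> forms d" and "GDERIV (eval2 P) (cos t, sin t) :> 0"
  shows "circle_deriv d (form_coeff d P) t = 0"
proof (rule DERIV_unique[OF circle_val_has_derivative])
  have 1: "((\<lambda>t. (cos t, sin t)) has_derivative (\<lambda>h. (- sin t * h, cos t * h))) (at t)"
    by (auto intro!: derivative_eq_intros)
  have 2: "(eval2 P has_derivative (\<lambda>h. 0)) (at (cos t, sin t))"
    using assms(2) by (simp add: gderiv_def)
  have "((\<lambda>t. eval2 P (cos t, sin t)) has_derivative (\<lambda>h. 0)) (at t)"
    using has_derivative_compose[OF 1 2] by simp
  then show "(circle_val d (form_coeff d P) has_real_derivative 0) (at t)"
    by (simp add: eval2_circle[OF P] has_field_derivative_def mult_zero_left[abs_def])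
qed

text \<open>The tangential derivative vanishes by assumption and the radial one by Euler's identity,
  so the whole gradient does.\<close>

lemma form_of_double_root:
  assumes v: "circle_val d a t = 0" and w: "circle_deriv d a t = 0"
  shows "form_of d a \<in> real_discriminant d"
proof -
  define x y where "x = cos t" and "y = sin t"
  define p where "p = (\<Sum>i\<le>d. a i * (real i * (x ^ (i - 1) * y ^ (d - i))))"
  define q where "q = (\<Sum>i\<le>d. a i * (real (d - i) * (x ^ i * y ^ (d - i - 1))))"
  have xy: "x * x + y * y = 1"
    by (simp add: x_def y_def flip: power2_eq_square)
  \<comment> \<open>Euler's identity for homogeneous polynomials; \<open>p\<close> and
    \<open>q\<close> are the partial derivatives at (x, y).\<close>
  have "x * p + y * q = (\<Sum>i\<le>d. real d * (a i * (x ^ i * y ^ (d - i))))"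
    unfolding p_def q_def sum_distrib_left sum.distrib[symmetric]
  proof (intro sum.cong refl)
    fix i assume "i \<in> {..d}"
    then have d: "real d = real i + real (d - i)" by simp
    have i: "real i * x ^ i = real i * (x * x ^ (i - 1))" by (cases i) auto
    have j: "real (d - i) * y ^ (d - i) = real (d - i) * (y * y ^ (d - i - 1))"
      by (cases "d - i") auto
    have "real d * (a i * (x ^ i * y ^ (d - i)))
      = a i * ((real i * x ^ i) * y ^ (d - i)) + a i * (x ^ i * (real (d - i) * y ^ (d - i)))"
      unfolding d by (simp add: algebra_simps)
    then show "x * (a i * (real i * (x ^ (i - 1) * y ^ (d - i)))) +
        y * (a i * (real (d - i) * (x ^ i * y ^ (d - i - 1)))) =
        real d * (a i * (x ^ i * y ^ (d - i)))"
      unfolding i j by (simp add: algebra_simps)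
  qed
  also have "\<dots> = real d * circle_val d a t"
    by (simp add: circle_val_def x_def y_def sum_distrib_left)
  finally have radial: "x * p + y * q = 0" using v by simp
  have "x * q - y * p = circle_deriv d a t"
    unfolding p_def q_def sum_distrib_left sum_subtractf[symmetric] circle_deriv_def
    by (intro sum.cong refl) (simp add: monom_deriv_def x_def y_def algebra_simps)
  then have tangential: "x * q - y * p = 0" using w by simp
  \<comment> \<open>Both partial derivatives are recovered by inverting the rotation to the radial
    and tangential frame.\<close>
  have "p = x * (x * p + y * q) - y * (x * q - y * p) + p * (1 - (x * x + y * y))"
    by (simp add: algebra_simps)
  then have p: "p = 0" by (simp add: radial tangential xy)
  have "q = y * (x * p + y * q) + x * (x * q - y * p) + q * (1 - (x * x + y * y))"
    by (simp add: algebra_simps)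
  then have q: "q = 0" by (simp add: radial tangential xy)
  have "((\<lambda>u. \<Sum>i\<le>d. a i * (fst u ^ i * snd u ^ (d - i))) has_derivative
      (\<lambda>h. \<Sum>i\<le>d. a i * (x ^ i * (real (d - i) * snd h * y ^ (d - i - 1))
         + real i * fst h * x ^ (i - 1) * y ^ (d - i)))) (at (x, y))"
    by (auto intro!: derivative_eq_intros)
  also have "(\<lambda>h. \<Sum>i\<le>d. a i * (x ^ i * (real (d - i) * snd h * y ^ (d - i - 1))
         + real i * fst h * x ^ (i - 1) * y ^ (d - i))) = (\<lambda>h. fst h * p + snd h * q)"
    unfolding p_def q_def sum_distrib_left sum.distrib[symmetric]
    by (intro ext sum.cong refl) (simp add: algebra_simps)
  finally have "(eval2 (form_of d a) has_derivative (\<lambda>h. 0)) (at (x, y))"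
    by (simp add: p q eval2_form_of[abs_def])
  moreover have "eval2 (form_of d a) (x, y) = 0"
    using v by (simp add: eval2_form_of circle_val_def x_def y_def)
  moreover have "norm (x, y) = 1"
    by (simp add: norm_Pair x_def y_def)
  ultimately show ?thesis
    unfolding real_discriminant_def by (auto simp: form_of_in_forms gderiv_def)
qed

lemma bombieri_norm_nonneg: "bombieri_norm d P \<ge> 0"
  by (simp add: bombieri_norm_eq coeff_inner_nonneg)

text \<open>\<open>residual\<close> supplies an explicit element of the discriminant; its distance
  from \<open>P\<close> is the norm of the removed projection.\<close>

lemma dist_discriminant_le:
  assumes "d > 0" "P \<in> forms d"
  shows "dist_discriminant d P \<le>
    sqrt ((circle_val d (form_coeff d P) t)\<^sup>2 + (circle_deriv d (form_coeff d P) t)\<^sup>2 / real d)"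
proof -
  let ?a = "form_coeff d P"
  let ?Q = "form_of d (residual d ?a t)"
  have "?Q \<in> real_discriminant d"
    using assms by (intro form_of_double_root[of _ _ t] circle_val_residual circle_deriv_residual)
  then have "dist_discriminant d P \<le> bombieri_norm d (P - ?Q)"
    unfolding dist_discriminant_def
    by (intro cINF_lower bdd_belowI2[of _ 0] bombieri_norm_nonneg)
  also have "coeff_inner d (form_coeff d (P - ?Q)) (form_coeff d (P - ?Q))
      = coeff_inner d (\<lambda>i. ?a i - residual d ?a t i) (\<lambda>i. ?a i - residual d ?a t i)"
    unfolding coeff_inner_def form_coeff_diff by (intro sum.cong) (auto simp: form_coeff_form_of)
  then have "bombieri_norm d (P - ?Q) = sqrt ((circle_val d ?a t)\<^sup>2 + (circle_deriv d ?a t)\<^sup>2 / real d)"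
    by (simp add: bombieri_norm_eq coeff_inner_projection assms)
  finally show ?thesis .
qed

text \<open>Subtracting a \<open>Q\<close> with a double root at t leaves the value and tangential
  derivative of \<open>P\<close> there unchanged, so \<open>bessel\<close> for the difference
  applies.\<close>

lemma dist_discriminant_ge:
  assumes "d > 0" "P \<in> forms d"
    and bound: "\<And>t. (circle_val d (form_coeff d P) t)\<^sup>2
      + (circle_deriv d (form_coeff d P) t)\<^sup>2 / real d \<ge> r\<^sup>2"
  shows "dist_discriminant d P \<ge> r"
  unfolding dist_discriminant_def
proof (rule cINF_greatest)
  have "form_of d (\<lambda>_. 0) \<in> real_discriminant d"
    by (rule form_of_double_root[where t = 0]) (simp_all add: circle_val_def circle_deriv_def)
  then show "real_discriminant d \<noteq> {}" by auto
next
  fix Q assume "Q \<in> real_discriminant d"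
  then obtain x y where Q: "Q \<in> forms d" and n: "norm (x, y) = 1"
    and z: "eval2 Q (x, y) = 0" "GDERIV (eval2 Q) (x, y) :> 0"
    by (auto simp: real_discriminant_def)
  from n have "x\<^sup>2 + y\<^sup>2 = 1" by (simp add: norm_Pair)
  then obtain t where t: "x = cos t" "y = sin t"
    using sincos_total_2pi by blast
  let ?a = "form_coeff d P" and ?b = "form_coeff d Q"
  have "circle_val d ?b t = 0" "circle_deriv d ?b t = 0"
    using z Q form_coeff_double_root by (auto simp: t eval2_circle)
  then have "circle_val d (\<lambda>i. ?a i - ?b i) t = circle_val d ?a t"
    "circle_deriv d (\<lambda>i. ?a i - ?b i) t = circle_deriv d ?a t"
    by (simp_all add: coeff_inner_point_kernel[symmetric] coeff_inner_tangent_kernel[symmetric] coeff_inner_linear)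
  then have "r\<^sup>2 \<le> coeff_inner d (form_coeff d (P - Q)) (form_coeff d (P - Q))"
    using bound[of t] bessel[OF \<open>d > 0\<close>, of "\<lambda>i. ?a i - ?b i" t] by (simp add: form_coeff_diff)
  then show "r \<le> bombieri_norm d (P - Q)"
    by (simp add: bombieri_norm_eq real_le_rsqrt)
qed

section \<open>Fourier coefficients from the coordinates x + iy, x - iy\<close>

lemma linear_mult_homogeneous:
  fixes b :: "nat \<Rightarrow> complex"
  shows "\<exists>b'. \<forall>X Y. (\<alpha> * X + \<beta> * Y) * (\<Sum>k\<le>n. b k * X ^ k * Y ^ (n - k))
    = (\<Sum>k\<le>Suc n. b' k * X ^ k * Y ^ (Suc n - k))"
proof (intro exI allI)
  fix X Y
  \<comment> \<open>Multiplying by \<open>X\<close> shifts the coefficients, multiplying by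
    \<open>Y\<close> keeps them; \<open>?v\<close> is cut off because \<open>b\<close> is arbitrary
    beyond \<open>n\<close>.\<close>
  let ?u = "\<lambda>k. if k = 0 then 0 else b (k - 1)" and ?v = "\<lambda>k. if k \<le> n then b k else 0"
  have u: "(\<Sum>k\<le>Suc n. ?u k * X ^ k * Y ^ (Suc n - k)) = X * (\<Sum>k\<le>n. b k * X ^ k * Y ^ (n - k))"
    by (subst sum.atMost_Suc_shift) (simp add: sum_distrib_left mult_ac)
  have v: "(\<Sum>k\<le>Suc n. ?v k * X ^ k * Y ^ (Suc n - k)) = Y * (\<Sum>k\<le>n. b k * X ^ k * Y ^ (n - k))"
    by (simp add: sum_distrib_left Suc_diff_le mult_ac)
  have "(\<Sum>k\<le>Suc n. (\<alpha> * ?u k + \<beta> * ?v k) * X ^ k * Y ^ (Suc n - k))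
    = \<alpha> * (\<Sum>k\<le>Suc n. ?u k * X ^ k * Y ^ (Suc n - k)) + \<beta> * (\<Sum>k\<le>Suc n. ?v k * X ^ k * Y ^ (Suc n - k))"
    by (simp only: sum_distrib_left sum.distrib[symmetric] distrib_right mult.assoc)
  then show "(\<alpha> * X + \<beta> * Y) * (\<Sum>k\<le>n. b k * X ^ k * Y ^ (n - k))
    = (\<Sum>k\<le>Suc n. (\<alpha> * ?u k + \<beta> * ?v k) * X ^ k * Y ^ (Suc n - k))"
    unfolding u v by (simp add: algebra_simps)
qed

text \<open>One linear factor is multiplied on at a time. The expansion serves both directions of
  the change of coordinates.\<close>

lemma linear_powers_homogeneous:
  fixes \<alpha> \<beta> \<gamma> \<delta> :: complex
  shows "\<exists>b. \<forall>X Y. (\<alpha> * X + \<beta> * Y) ^ i * (\<gamma> * X + \<delta> * Y) ^ j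
    = (\<Sum>k\<le>i + j. b k * X ^ k * Y ^ (i + j - k))"
proof (induction i)
  case 0
  show ?case
  proof (induction j)
    case 0
    show ?case by (rule exI[of _ "\<lambda>_. 1"]) simp
  next
    case (Suc j)
    then obtain b where
      "\<forall>X Y. (\<gamma> * X + \<delta> * Y) ^ j = (\<Sum>k\<le>j. b k * X ^ k * Y ^ (j - k))"
      by auto
    with linear_mult_homogeneous[where \<alpha> = \<gamma> and \<beta> = \<delta> and n = j and b = b] show ?case by simp
  qed
next
  case (Suc i)
  then obtain b where
    "\<forall>X Y. (\<alpha> * X + \<beta> * Y) ^ i * (\<gamma> * X + \<delta> * Y) ^ j
      = (\<Sum>k\<le>i + j. b k * X ^ k * Y ^ (i + j - k))"
    by auto
  with linear_mult_homogeneous[where \<alpha> = \<alpha> and \<beta> = \<beta> and n = "i + j" and b = b] show ?case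
    by (simp add: mult.assoc)
qed

text \<open>\<^term>\<open>c\<close> holds the coefficients of the form in the coordinates $x + iy$, $x - iy$, which
  become its Fourier coefficients on the unit circle.\<close>

definition conj_coeffs :: "nat \<Rightarrow> (nat \<Rightarrow> real) \<Rightarrow> (nat \<Rightarrow> complex) \<Rightarrow> bool"
  where "conj_coeffs d a c \<longleftrightarrow> (\<forall>X Y. (\<Sum>i\<le>d. of_real (a i) * X ^ i * Y ^ (d - i))
    = (\<Sum>j\<le>d. c j * (X + \<i> * Y) ^ j * (X - \<i> * Y) ^ (d - j)))"

lemma conj_coeffs_exist: "\<exists>c. conj_coeffs d a c"
proof -
  \<comment> \<open>With U = X + iY and V = X - iY the two factors are powers of X = (U + V)/2 and Y
    = (U - V)/(2i).\<close>
  have "\<exists>b. \<forall>U V. (1/2 * U + 1/2 * V) ^ i * (- \<i>/2 * U + \<i>/2 * V) ^ (d - i)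
    = (\<Sum>k\<le>d. b k * U ^ k * V ^ (d - k))" if "i \<le> d" for i
    using linear_powers_homogeneous[of "1/2" "1/2" i "- \<i>/2" "\<i>/2" "d - i"] that by simp
  then obtain b where b: "\<And>i U V. i \<le> d \<Longrightarrow>
      (1/2 * U + 1/2 * V) ^ i * (- \<i>/2 * U + \<i>/2 * V) ^ (d - i)
      = (\<Sum>k\<le>d. b i k * U ^ k * V ^ (d - k))"
    by metis
  have "(\<Sum>i\<le>d. of_real (a i) * X ^ i * Y ^ (d - i))
    = (\<Sum>j\<le>d. (\<Sum>i\<le>d. of_real (a i) * b i j) * (X + \<i> * Y) ^ j * (X - \<i> * Y) ^ (d - j))" for X Y
  proof -
    have X: "1/2 * (X + \<i> * Y) + 1/2 * (X - \<i> * Y) = X" by (simp add: field_simps)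
    have Y: "- \<i>/2 * (X + \<i> * Y) + \<i>/2 * (X - \<i> * Y) = Y" by (simp add: field_simps)
    have "(\<Sum>i\<le>d. of_real (a i) * X ^ i * Y ^ (d - i))
      = (\<Sum>i\<le>d. of_real (a i) * (\<Sum>k\<le>d. b i k * (X + \<i> * Y) ^ k * (X - \<i> * Y) ^ (d - k)))"
    proof (intro sum.cong refl)
      fix i assume "i \<in> {..d}"
      then show "of_real (a i) * X ^ i * Y ^ (d - i)
        = of_real (a i) * (\<Sum>k\<le>d. b i k * (X + \<i> * Y) ^ k * (X - \<i> * Y) ^ (d - k))"
        using b[of i "X + \<i> * Y" "X - \<i> * Y"] unfolding X Y by (simp add: mult.assoc)
    qed
    also have "\<dots> = (\<Sum>j\<le>d. \<Sum>i\<le>d. of_real (a i) * (b i j * (X + \<i> * Y) ^ j * (X - \<i> * Y) ^ (d - j)))"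
      unfolding sum_distrib_left by (rule sum.swap)
    finally show ?thesis by (simp add: sum_distrib_right mult.assoc)
  qed
  then show ?thesis unfolding conj_coeffs_def by (intro exI allI)
qed

text \<open>Expanding the powers of X + iY and X - iY writes each \<open>a i\<close> as a fixed
  linear combination of the \<open>c j\<close>, so the constant depends on \<open>d\<close>
  only.\<close>

lemma coeff_inner_le_conj_coeffs:
  obtains C where "C > 0"
    "\<And>a c M. conj_coeffs d a c \<Longrightarrow> (\<And>j. j \<le> d \<Longrightarrow> cmod (c j) \<le> M) \<Longrightarrow>
      coeff_inner d a a \<le> (C * M)\<^sup>2"
proof -
  have "\<exists>b. \<forall>X Y. (X + \<i> * Y) ^ j * (X - \<i> * Y) ^ (d - j)
    = (\<Sum>k\<le>d. b k * X ^ k * Y ^ (d - k))" if "j \<le> d" for j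
    using linear_powers_homogeneous[of 1 \<i> j 1 "- \<i>" "d - j"] that by simp
  then obtain b where b: "\<And>j X Y. j \<le> d \<Longrightarrow> (X + \<i> * Y) ^ j * (X - \<i> * Y) ^ (d - j)
      = (\<Sum>k\<le>d. b j k * X ^ k * Y ^ (d - k))"
    by metis
  define S where "S = (\<Sum>i\<le>d. \<Sum>j\<le>d. cmod (b j i)) + 1"
  have S: "S \<ge> 1" by (auto simp: S_def intro!: sum_nonneg)
  show ?thesis
  proof (rule that[of "real (Suc d) * S"])
    show "real (Suc d) * S > 0" using S by simp
    fix a c M
    assume ac: "conj_coeffs d a c" and M: "\<And>j. j \<le> d \<Longrightarrow> cmod (c j) \<le> M"
    have M0: "M \<ge> 0" using M[of 0] norm_ge_zero[of "c 0"] by linarith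
    \<comment> \<open>Setting Y = 1 leaves polynomials in one variable, whose coefficients can be
      compared.\<close>
    have "(\<Sum>i\<le>d. of_real (a i) * X ^ i) = (\<Sum>i\<le>d. (\<Sum>j\<le>d. c j * b j i) * X ^ i)" for X
    proof -
      have "(\<Sum>i\<le>d. of_real (a i) * X ^ i)
        = (\<Sum>j\<le>d. c j * ((X + \<i> * 1) ^ j * (X - \<i> * 1) ^ (d - j)))"
        using ac[unfolded conj_coeffs_def, rule_format, of X 1] by (simp add: mult.assoc)
      also have "\<dots> = (\<Sum>j\<le>d. \<Sum>i\<le>d. c j * (b j i * X ^ i * 1 ^ (d - i)))"
        unfolding sum_distrib_left[symmetric] by (intro sum.cong refl) (simp only: b atMost_iff)
      also have "\<dots> = (\<Sum>i\<le>d. \<Sum>j\<le>d. c j * (b j i * X ^ i * 1 ^ (d - i)))"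
        by (rule sum.swap)
      finally show ?thesis by (simp add: sum_distrib_right mult.assoc)
    qed
    then have eq: "of_real (a i) = (\<Sum>j\<le>d. c j * b j i)" if "i \<le> d" for i
      using polyfun_eq_coeffs[of "\<lambda>i. of_real (a i) :: complex" d "\<lambda>i. \<Sum>j\<le>d. c j * b j i"] that
      by blast
    have "a i * a i / real (d choose i) \<le> (S * M)\<^sup>2" if i: "i \<le> d" for i
    proof -
      have "\<bar>a i\<bar> = cmod (\<Sum>j\<le>d. c j * b j i)"
        by (simp flip: eq[OF i])
      also have "\<dots> \<le> (\<Sum>j\<le>d. M * cmod (b j i))"
        by (intro sum_norm_le) (auto simp: norm_mult intro!: mult_right_mono M)
      also have "\<dots> = M * (\<Sum>j\<le>d. cmod (b j i))"
        by (simp add: sum_distrib_left)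
      also have "(\<Sum>j\<le>d. cmod (b j i)) \<le> (\<Sum>i\<le>d. \<Sum>j\<le>d. cmod (b j i))"
        using i by (intro member_le_sum) (auto intro!: sum_nonneg)
      then have "M * (\<Sum>j\<le>d. cmod (b j i)) \<le> M * S"
        using M0 by (intro mult_left_mono) (auto simp: S_def)
      finally have "\<bar>a i\<bar>\<^sup>2 \<le> (S * M)\<^sup>2"
        by (intro power_mono) (auto simp: mult.commute)
      moreover have "a i * a i / real (d choose i) \<le> a i * a i / 1"
        using i by (intro divide_left_mono) (auto simp: Suc_le_eq)
      ultimately show ?thesis by (simp add: power2_eq_square)
    qed
    then have "coeff_inner d a a \<le> (\<Sum>i\<le>d. (S * M)\<^sup>2)"
      unfolding coeff_inner_def by (intro sum_mono) auto
    also have "\<dots> = real (Suc d) * (S * M)\<^sup>2" by simp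
    also have "\<dots> \<le> (real (Suc d))\<^sup>2 * (S * M)\<^sup>2"
      by (intro mult_right_mono) (auto simp: power2_eq_square)
    finally show "coeff_inner d a a \<le> (real (Suc d) * S * M)\<^sup>2"
      by (simp add: power_mult_distrib)
  qed
qed

text \<open>The value of the form at the isotropic point (1, i), where x + iy vanishes.\<close>

definition val_at_i :: "nat \<Rightarrow> (nat \<Rightarrow> real) \<Rightarrow> complex"
  where "val_at_i d a = (\<Sum>i\<le>d. of_real (a i) * \<i> ^ (d - i))"

text \<open>At (1, i) and (1, -i) one of the factors X + iY, X - iY is 0 and the other is 2, so a
  single summand survives.\<close>

lemma conj_coeffs_extreme:
  assumes "conj_coeffs d a c"
  shows "c 0 = val_at_i d a / 2 ^ d" "c d = cnj (val_at_i d a) / 2 ^ d"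
proof -
  have "(\<Sum>j\<le>d. c j * (1 + \<i> * \<i>) ^ j * (1 - \<i> * \<i>) ^ (d - j)) = c 0 * 2 ^ d"
    by (subst sum.mono_neutral_cong_right[where S = "{0}" and h = "\<lambda>_. c 0 * 2 ^ d"]) auto
  moreover have "(\<Sum>j\<le>d. c j * (1 + \<i> * (- \<i>)) ^ j * (1 - \<i> * (- \<i>)) ^ (d - j)) = c d * 2 ^ d"
    by (subst sum.mono_neutral_cong_right[where S = "{d}" and h = "\<lambda>_. c d * 2 ^ d"]) auto
  moreover have "cnj (val_at_i d a) = (\<Sum>i\<le>d. of_real (a i) * (- \<i>) ^ (d - i))"
    by (simp add: val_at_i_def)
  ultimately have "val_at_i d a = c 0 * 2 ^ d" "cnj (val_at_i d a) = c d * 2 ^ d"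
    using assms[unfolded conj_coeffs_def, rule_format, of 1 \<i>]
      assms[unfolded conj_coeffs_def, rule_format, of 1 "- \<i>"]
    by (simp_all add: val_at_i_def del: cnj_sum)
  then show "c 0 = val_at_i d a / 2 ^ d" "c d = cnj (val_at_i d a) / 2 ^ d"
    by simp_all
qed

text \<open>On the circle x + iy and x - iy become e^(it) and e^(-it), so \<open>c j\<close> carries
  the frequency 2j - d.\<close>

lemma circle_val_conj_coeffs:
  assumes "conj_coeffs d a c"
  shows "complex_of_real (circle_val d a t) = (\<Sum>j\<le>d. c j * cis ((2 * real j - real d) * t))"
proof -
  have "cos (complex_of_real t) + \<i> * sin (complex_of_real t) = cis t"
    "cos (complex_of_real t) - \<i> * sin (complex_of_real t) = cis (- t)"
    by (simp_all add: complex_eq_iff cos_of_real sin_of_real)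
  moreover have "complex_of_real (circle_val d a t)
    = (\<Sum>i\<le>d. of_real (a i) * cos (of_real t) ^ i * sin (of_real t) ^ (d - i))"
    by (simp add: circle_val_def mult.assoc cos_of_real sin_of_real)
  ultimately have "complex_of_real (circle_val d a t) = (\<Sum>j\<le>d. c j * cis t ^ j * cis (- t) ^ (d - j))"
    using assms[unfolded conj_coeffs_def, rule_format, of "cos (of_real t)" "sin (of_real t)"] by simp
  also have "\<dots> = (\<Sum>j\<le>d. c j * cis ((2 * real j - real d) * t))"
    by (intro sum.cong refl)
      (simp add: Complex.DeMoivre mult.assoc cis_mult of_nat_diff algebra_simps)
  finally show ?thesis .
qed

section \<open>Sampling at \<open>d\<close> equally spaced angles\<close>

lemma sum_cis_period:
  fixes m :: int
  assumes "d > 0"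
  shows "(\<Sum>k<d. cis (2 * pi * of_int m * real k / real d)) = (if int d dvd m then of_nat d else 0)"
proof -
  define w where "w = cis (2 * pi * of_int m / real d)"
  have w: "cis (2 * pi * of_int m * real k / real d) = w ^ k" for k
    by (simp add: w_def Complex.DeMoivre mult_ac)
  show ?thesis
  proof (cases "int d dvd m")
    case True
    then obtain n where "m = int d * n" by auto
    with assms have "2 * pi * of_int m / real d = 2 * pi * of_int n" by simp
    then have "w = 1" by (simp only: w_def cis_multiple_2pi Ints_of_int)
    with True show ?thesis by (simp add: w)
  next
    case False
    have "w \<noteq> 1"
    proof
      assume "w = 1"
      then have "cos (2 * pi * of_int m / real d) = 1"
        by (metis w_def cis.sel(1) one_complex.sel(1))
      then obtain n where "2 * pi * of_int m / real d = of_int n * 2 * pi"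
        by (auto simp: cos_one_2pi_int)
      with assms have "real_of_int m = real_of_int (n * int d)"
        by (simp add: field_simps)
      then have "m = n * int d" by linarith
      with False show False by simp
    qed
    moreover have "w ^ d = 1"
      using assms cis_multiple_2pi[of "of_int m"] by (simp flip: w)
    ultimately show ?thesis
      using False by (simp add: w geometric_sum)
  qed
qed

text \<open>All frequencies have the parity of \<open>d\<close>, so steps of pi/d, covering half the
  circle, already separate the indices modulo \<open>d\<close>. Among the d + 1 indices only 0 and
  \<open>d\<close> are aliased.\<close>

lemma circle_val_dft:
  assumes d: "d > 0" and c: "conj_coeffs d a c" and l: "l \<le> d"
  shows "(\<Sum>k<d. complex_of_real (circle_val d a (real k * pi / real d + \<phi>))
      * cis (- (2 * real l - real d) * (real k * pi / real d)))
    = of_nat d * (\<Sum>j | j \<le> d \<and> int d dvd int j - int l. c j * cis ((2 * real j - real d) * \<phi>))"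
proof -
  have e: "cis ((2 * real j - real d) * (real k * pi / real d + \<phi>))
      * cis (- (2 * real l - real d) * (real k * pi / real d))
    = cis ((2 * real j - real d) * \<phi>) * cis (2 * pi * of_int (int j - int l) * real k / real d)"
    for j k
  proof -
    have "(2 * real j - real d) * (real k * pi / real d + \<phi>) + - (2 * real l - real d) * (real k * pi / real d)
      = (2 * real j - real d) * \<phi> + 2 * pi * of_int (int j - int l) * real k / real d"
      using d by (simp add: field_simps)
    then show ?thesis by (simp only: cis_mult)
  qed
  have "(\<Sum>k<d. complex_of_real (circle_val d a (real k * pi / real d + \<phi>))
      * cis (- (2 * real l - real d) * (real k * pi / real d)))
    = (\<Sum>k<d. \<Sum>j\<le>d. c j * (cis ((2 * real j - real d) * \<phi>)
        * cis (2 * pi * of_int (int j - int l) * real k / real d)))"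
    unfolding circle_val_conj_coeffs[OF c] sum_distrib_right e[symmetric] by (simp add: mult.assoc)
  also have "\<dots> = (\<Sum>j\<le>d. \<Sum>k<d. c j * (cis ((2 * real j - real d) * \<phi>)
        * cis (2 * pi * of_int (int j - int l) * real k / real d)))"
    by (rule sum.swap)
  also have "\<dots> = (\<Sum>j\<le>d. if int d dvd int j - int l
      then of_nat d * (c j * cis ((2 * real j - real d) * \<phi>)) else 0)"
    unfolding sum_distrib_left[symmetric] sum_cis_period[OF d] by (intro sum.cong) auto
  also have "\<dots> = (\<Sum>j | j \<le> d \<and> int d dvd int j - int l. of_nat d * (c j * cis ((2 * real j - real d) * \<phi>)))"
    by (simp add: sum.If_cases Int_def)
  finally show ?thesis by (simp add: sum_distrib_left)
qed

text \<open>The transform at index 0: its characters are the signs (-1)^k, and it sees the aliased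
  pair \<open>c 0\<close>, \<open>c d\<close>, whose contributions are conjugate.\<close>

lemma sum_alternating_circle_val:
  assumes d: "d > 0"
  shows "(\<Sum>k<d. (- 1) ^ k * circle_val d a (real k * pi / real d + \<phi>))
    = real d * Re (cis (- real d * \<phi>) * val_at_i d a) / 2 ^ (d - 1)"
proof -
  obtain c where c: "conj_coeffs d a c"
    using conj_coeffs_exist by blast
  let ?z = "cis (- real d * \<phi>) * val_at_i d a"
  have cis: "cis (- (2 * real 0 - real d) * (real k * pi / real d)) = of_real ((- 1) ^ k)" for k
    using d by (simp add: complex_eq_iff)
  have "{j. j \<le> d \<and> int d dvd int j - int 0} = {0, d}"
    using d by (auto dest: dvd_imp_le)
  then have "(\<Sum>j | j \<le> d \<and> int d dvd int j - int 0. c j * cis ((2 * real j - real d) * \<phi>))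
      = c 0 * cis (- real d * \<phi>) + c d * cis (real d * \<phi>)"
    using d by simp
  also have "\<dots> = (?z + cnj ?z) / 2 ^ d"
    by (simp add: conj_coeffs_extreme[OF c] cis_cnj add_divide_distrib mult.commute)
  also have "\<dots> = of_real (2 * Re ?z / 2 ^ d)"
    unfolding complex_add_cnj by (simp only: of_real_divide of_real_power of_real_numeral)
  also have "2 * r / 2 ^ d = r / 2 ^ (d - 1)" for r :: real
    using d by (cases d) auto
  finally have "complex_of_real (\<Sum>k<d. (- 1) ^ k * circle_val d a (real k * pi / real d + \<phi>))
      = of_real (real d * (Re ?z / 2 ^ (d - 1)))"
    using circle_val_dft[OF d c, of 0 \<phi>] unfolding cis by (simp add: mult.commute)
  then show ?thesis
    unfolding of_real_eq_iff by simp
qed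

text \<open>The samples determine the inner Fourier coefficients, but of the pair
  \<open>c 0\<close>, \<open>c d\<close> only a real part. The condition on Im supplies the rest; it
  says that the form is orthogonal to the \<open>\<phi>\<close>-derivative of the rotated T.\<close>

lemma coeff_inner_le_samples:
  assumes d: "d > 0"
  obtains C where "C > 0"
    "\<And>a \<phi> M. Im (cis (- real d * \<phi>) * val_at_i d a) = 0 \<Longrightarrow>
      (\<And>k. k < d \<Longrightarrow> \<bar>circle_val d a (real k * pi / real d + \<phi>)\<bar> \<le> M) \<Longrightarrow>
      coeff_inner d a a \<le> (C * M)\<^sup>2"
proof -
  obtain C where C: "C > 0"
    "\<And>a c M. conj_coeffs d a c \<Longrightarrow> (\<And>j. j \<le> d \<Longrightarrow> cmod (c j) \<le> M) \<Longrightarrow>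
      coeff_inner d a a \<le> (C * M)\<^sup>2"
    using coeff_inner_le_conj_coeffs[of d] by blast
  show ?thesis
  proof (rule that[OF C(1)])
    fix a \<phi> M
    assume Im0: "Im (cis (- real d * \<phi>) * val_at_i d a) = 0"
      and M: "\<And>k. k < d \<Longrightarrow> \<bar>circle_val d a (real k * pi / real d + \<phi>)\<bar> \<le> M"
    obtain c where c: "conj_coeffs d a c"
      using conj_coeffs_exist by blast
    have "cmod (c j) \<le> M" if j: "j \<le> d" for j
    proof (cases "j = 0 \<or> j = d")
      case True
      let ?z = "cis (- real d * \<phi>) * val_at_i d a"
      have "cmod (c j) = cmod (val_at_i d a) / 2 ^ d"
        using True conj_coeffs_extreme[OF c] by (auto simp: norm_divide norm_power)
      also have "cmod (val_at_i d a) = cmod ?z"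
        by (simp add: norm_mult)
      also have "\<dots> = \<bar>Re ?z\<bar>"
        using Im0 by (simp only: cmod_eq_Re)
      also have "\<bar>Re ?z\<bar> / 2 ^ d \<le> \<bar>Re ?z\<bar> / 2 ^ (d - 1)"
        by (intro divide_left_mono) (auto intro!: power_increasing)
      also have "\<dots> \<le> M"
      proof -
        have "real d * (\<bar>Re ?z\<bar> / 2 ^ (d - 1)) = \<bar>real d * Re ?z / 2 ^ (d - 1)\<bar>"
          by (simp add: abs_mult)
        also have "\<dots> \<le> (\<Sum>k<d. \<bar>(- 1) ^ k * circle_val d a (real k * pi / real d + \<phi>)\<bar>)"
          unfolding sum_alternating_circle_val[OF d, symmetric] by (rule sum_abs)
        also have "\<dots> \<le> (\<Sum>k<d. M)"
          by (intro sum_mono) (auto simp: abs_mult power_abs intro: M)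
        finally have "real d * (\<bar>Re ?z\<bar> / 2 ^ (d - 1)) \<le> real d * M"
          by (simp only: sum_constant card_lessThan)
        then show ?thesis
          using d by (simp only: mult_le_cancel_left_pos of_nat_0_less_iff)
      qed
      finally show ?thesis .
    next
      case False
      \<comment> \<open>Distinct indices up to \<open>d\<close> differ by less than \<open>d\<close>
        unless they are 0 and \<open>d\<close>, so an inner index has no alias.\<close>
      have "{i. i \<le> d \<and> int d dvd int i - int j} = {j}"
      proof safe
        fix i assume "i \<le> d" "int d dvd int i - int j"
        moreover have "\<bar>int i - int j\<bar> < int d"
          using \<open>i \<le> d\<close> j False by auto
        ultimately show "i = j"
          using dvd_imp_le_int[of "int i - int j" "int d"] by fastforce
      qed (use j in auto)
      then have "of_nat d * (c j * cis ((2 * real j - real d) * \<phi>))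
        = (\<Sum>k<d. complex_of_real (circle_val d a (real k * pi / real d + \<phi>))
          * cis (- (2 * real j - real d) * (real k * pi / real d)))"
        unfolding circle_val_dft[OF d c j] by simp
      then have "real d * cmod (c j) = cmod \<dots>"
        by (metis norm_mult norm_of_nat norm_cis mult.right_neutral)
      also have "\<dots> \<le> (\<Sum>k<d. M)"
        by (intro sum_norm_le) (auto simp: norm_mult intro: M)
      finally show ?thesis using d by simp
    qed
    then show "coeff_inner d a a \<le> (C * M)\<^sup>2" by (rule C(2)[OF c])
  qed
qed

section \<open>The rotation orbit of T\<close>

text \<open>The coefficients of $T_{d,d}$ rotated by $\varphi$, that is of
  $\mathrm{Re}\,(e^{-id\varphi}(x+iy)^d)$.\<close>

definition rotated_T :: "nat \<Rightarrow> real \<Rightarrow> nat \<Rightarrow> real"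
  where "rotated_T d \<phi> i = real (d choose i) * Re (cis (- real d * \<phi>) * \<i> ^ (d - i))"

text \<open>The binomial factor cancels the weight, leaving the value at (1, i). The argument of
  that value will therefore give the nearest rotation.\<close>

lemma coeff_inner_rotated_T:
  "coeff_inner d a (rotated_T d \<phi>) = Re (cis (- real d * \<phi>) * val_at_i d a)"
proof -
  have "coeff_inner d a (rotated_T d \<phi>) = (\<Sum>i\<le>d. a i * Re (cis (- real d * \<phi>) * \<i> ^ (d - i)))"
    unfolding coeff_inner_def rotated_T_def by (intro sum.cong) auto
  also have "\<dots> = Re (\<Sum>i\<le>d. of_real (a i) * (cis (- real d * \<phi>) * \<i> ^ (d - i)))"
    unfolding Re_sum by (intro sum.cong refl) simp
  finally show ?thesis by (simp only: val_at_i_def sum_distrib_left mult.left_commute)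
qed

text \<open>Writing Re z as (z + cnj z)/2 splits the sum into the binomial expansions of (1 - 1)^d =
  0 and (1 + 1)^d.\<close>

lemma val_at_i_rotated_T:
  assumes "d > 0"
  shows "val_at_i d (rotated_T d \<phi>) = 2 ^ (d - 1) * cis (real d * \<phi>)"
proof -
  let ?w = "cis (- real d * \<phi>)"
  have "complex_of_real (rotated_T d \<phi> i) * \<i> ^ (d - i)
    = (?w * (of_nat (d choose i) * 1 ^ i * (- 1) ^ (d - i))
      + cnj ?w * (of_nat (d choose i) * 1 ^ i * 1 ^ (d - i))) / 2" for i
  proof -
    have re: "complex_of_real (Re z) = (z + cnj z) / 2" for z
      by (simp add: complex_add_cnj)
    have "complex_of_real (rotated_T d \<phi> i) * \<i> ^ (d - i)
      = of_nat (d choose i) * (?w * (\<i> ^ (d - i) * \<i> ^ (d - i))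
         + cnj ?w * ((- \<i>) ^ (d - i) * \<i> ^ (d - i))) / 2"
      unfolding rotated_T_def of_real_mult re complex_cnj_mult complex_cnj_power complex_cnj_i
      by (simp add: algebra_simps)
    then show ?thesis
      by (simp add: algebra_simps flip: power_mult_distrib)
  qed
  then have "val_at_i d (rotated_T d \<phi>) = (?w * (1 + - 1) ^ d + cnj ?w * (1 + 1) ^ d) / 2"
    unfolding val_at_i_def binomial_ring
    by (simp only: sum_divide_distrib[symmetric] sum.distrib sum_distrib_left)
  moreover have "(1 + - 1 :: complex) ^ d = 0" "(1 + 1 :: complex) ^ d = 2 * 2 ^ (d - 1)"
    using assms by (cases d; simp)+
  ultimately show ?thesis
    using assms by (simp add: cis_cnj zero_power)
qed

lemma circle_val_rotated_T: "circle_val d (rotated_T d \<phi>) t = cos (real d * (t - \<phi>))"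
proof -
  let ?w = "cis (- real d * \<phi>)"
  have "circle_val d (rotated_T d \<phi>) t
    = Re (\<Sum>i\<le>d. ?w * (of_nat (d choose i) * of_real (cos t) ^ i * (\<i> * of_real (sin t)) ^ (d - i)))"
    unfolding circle_val_def Re_sum rotated_T_def
  proof (intro sum.cong refl)
    fix i
    have re: "Re (of_real r * z) = r * Re z" for r z by simp
    have eq: "?w * (of_nat (d choose i) * of_real (cos t) ^ i * (\<i> * of_real (sin t)) ^ (d - i))
      = of_real (real (d choose i) * (cos t ^ i * sin t ^ (d - i))) * (?w * \<i> ^ (d - i))"
      by (simp add: power_mult_distrib mult_ac)
    show "real (d choose i) * Re (?w * \<i> ^ (d - i)) * (cos t ^ i * sin t ^ (d - i))
      = Re (?w * (of_nat (d choose i) * of_real (cos t) ^ i * (\<i> * of_real (sin t)) ^ (d - i)))"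
      unfolding eq re by (simp only: mult_ac)
  qed
  also have "\<dots> = Re (?w * (of_real (cos t) + \<i> * of_real (sin t)) ^ d)"
    by (simp only: binomial_ring sum_distrib_left)
  also have "of_real (cos t) + \<i> * of_real (sin t) = cis t"
    by (simp add: complex_eq_iff)
  finally show ?thesis
    by (simp add: Complex.DeMoivre cis_mult algebra_simps)
qed

lemma circle_deriv_rotated_T: "circle_deriv d (rotated_T d \<phi>) t = - real d * sin (real d * (t - \<phi>))"
proof (rule DERIV_unique[OF circle_val_has_derivative])
  show "(circle_val d (rotated_T d \<phi>) has_real_derivative - real d * sin (real d * (t - \<phi>))) (at t)"
    unfolding circle_val_rotated_T[abs_def] by (auto intro!: derivative_eq_intros)
qed

lemma coeff_inner_rotated_T_self: "d > 0 \<Longrightarrow> coeff_inner d (rotated_T d \<phi>) (rotated_T d \<phi>) = 2 ^ (d - 1)"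
  unfolding coeff_inner_rotated_T val_at_i_rotated_T
  by (simp add: mult.left_commute[of "cis _"] cis_mult)

lemma form_coeff_T_form: "form_coeff d (T_form d) = rotated_T d 0"
proof
  fix i
  show "form_coeff d (T_form d) i = rotated_T d 0 i"
  proof (cases "i \<le> d")
    \<comment> \<open>Beyond \<open>d\<close> the difference \<open>d - i\<close> truncates to 0,
      yet both sides vanish: one by homogeneity, the other through the binomial coefficient.\<close>
    case False
    then have "coeff2 (T_form d) i (d - i) = 0"
      using T_form_in_forms[of d] unfolding forms_def by force
    with False show ?thesis
      by (simp add: form_coeff_def rotated_T_def binomial_eq_0)
  next
    case True
    have "form_coeff d (T_form d) i
      = (\<Sum>k\<le>d div 2. if 2 * k = d - i then (- 1) ^ k * real (d choose (2 * k)) else 0)"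
      unfolding form_coeff_def coeff2_def T_form_def coeff_sum
      using True by (intro sum.cong) (auto simp: coeff_monom)
    also have "\<dots> = rotated_T d 0 i"
    proof (cases "even (d - i)")
      case True
      then obtain k where k: "d - i = 2 * k" by blast
      then have "k \<le> d div 2" "d choose (2 * k) = d choose i"
        using \<open>i \<le> d\<close> binomial_symmetric[of i d] by auto
      moreover have "\<i> ^ (d - i) = of_real ((- 1) ^ k)"
        by (simp add: k power_mult)
      ultimately show ?thesis
        by (simp add: k rotated_T_def)
    next
      case False
      then obtain k where k: "d - i = 2 * k + 1" by (blast elim: oddE)
      then have "\<i> ^ (d - i) = \<i> * of_real ((- 1) ^ k)"
        by (simp add: power_mult)
      then have "rotated_T d 0 i = 0"
        by (simp add: rotated_T_def)
      moreover have "2 * k \<noteq> d - i" for k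
        using False by (metis dvd_triv_left)
      ultimately show ?thesis by simp
    qed
    finally show ?thesis .
  qed
qed

section \<open>Forms near T with the same norm\<close>

text \<open>Here \<open>2 ^ (d - 1)\<close> is the squared norm of T, and 1 is the value that T
  never goes below.\<close>

lemma near_T_small_value:
  assumes d: "d > 0"
  obtains \<epsilon> where "\<epsilon> > 0"
    "\<And>a. coeff_inner d a a = 2 ^ (d - 1) \<Longrightarrow>
      coeff_inner d (\<lambda>i. a i - rotated_T d 0 i) (\<lambda>i. a i - rotated_T d 0 i) < \<epsilon>\<^sup>2 \<Longrightarrow>
      \<exists>t. (circle_val d a t)\<^sup>2 + (circle_deriv d a t)\<^sup>2 / real d \<le> 1"
proof -
  obtain C where C: "C > 0"
    "\<And>a \<phi> M. Im (cis (- real d * \<phi>) * val_at_i d a) = 0 \<Longrightarrow>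
      (\<And>k. k < d \<Longrightarrow> \<bar>circle_val d a (real k * pi / real d + \<phi>)\<bar> \<le> M) \<Longrightarrow>
      coeff_inner d a a \<le> (C * M)\<^sup>2"
    using coeff_inner_le_samples[OF d] by blast
  show ?thesis
  \<comment> \<open>With this radius, 0 < \<open>\<eta>\<close> < \<open>\<epsilon>\<^sup>2\<close>
    gives (C d \<open>\<eta>\<close>)^2 < \<open>\<eta>\<close>, the final contradiction.\<close>
  proof (rule that[of "1 / (C * real d)"])
    show "1 / (C * real d) > 0" using C d by simp
    fix a
    assume norm_a: "coeff_inner d a a = 2 ^ (d - 1)"
      and near: "coeff_inner d (\<lambda>i. a i - rotated_T d 0 i) (\<lambda>i. a i - rotated_T d 0 i)
        < (1 / (C * real d))\<^sup>2"
    define Z where "Z = val_at_i d a"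
    \<comment> \<open>This angle turns \<open>Z\<close> into its modulus and so maximises the
      product of \<open>a\<close> with the rotations of T; if \<open>Z\<close> is 0, any angle would
      do.\<close>
    define \<phi> where "\<phi> = Arg Z / real d"
    define h where "h = (\<lambda>i. a i - rotated_T d \<phi> i)"
    define \<eta> where "\<eta> = coeff_inner d h h"
    define s where "s k = (- 1) ^ k * circle_val d h (real k * pi / real d + \<phi>)" for k :: nat
    have Z: "cis (- real d * \<phi>) * Z = of_real (cmod Z)"
    proof -
      have "Z = of_real (cmod Z) * cis (Arg Z)"
        using rcis_cmod_Arg[of Z] by (simp add: rcis_def)
      then have "cis (- real d * \<phi>) * Z = of_real (cmod Z) * (cis (- Arg Z) * cis (Arg Z))"
        using d by (metis \<phi>_def mult.left_commute mult_minus_left nonzero_mult_div_cancel_left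
            of_nat_0_less_iff order_less_irrefl times_divide_eq_right)
      then show ?thesis by (simp add: cis_mult)
    qed
    \<comment> \<open>As \<open>a\<close> and every rotation have the same norm, the distance is
      smallest where the product is largest.\<close>
    have norm_diff: "coeff_inner d (\<lambda>i. a i - rotated_T d \<psi> i) (\<lambda>i. a i - rotated_T d \<psi> i)
      = 2 * 2 ^ (d - 1) - 2 * Re (cis (- real d * \<psi>) * Z)" for \<psi>
      unfolding coeff_inner_diff_left coeff_inner_diff_right norm_a
        coeff_inner_commute[of d "rotated_T d \<psi>" a] coeff_inner_rotated_T_self[OF d]
      unfolding coeff_inner_rotated_T Z_def[symmetric] by simp
    have \<eta>: "\<eta> = 2 * (2 ^ (d - 1) - cmod Z)"
      unfolding \<eta>_def h_def norm_diff Z by simp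
    \<comment> \<open>The nearest rotation is no farther than T itself, so the assumption
      \<open>near\<close> passes to \<open>\<eta>\<close>.\<close>
    have "\<eta> \<le> coeff_inner d (\<lambda>i. a i - rotated_T d 0 i) (\<lambda>i. a i - rotated_T d 0 i)"
      unfolding \<eta> norm_diff using complex_Re_le_cmod[of Z] by simp
    with near have \<eta>_less: "\<eta> < (1 / (C * real d))\<^sup>2" by linarith
    have \<eta>0: "\<eta> \<ge> 0" unfolding \<eta>_def by (rule coeff_inner_nonneg)
    \<comment> \<open>Being real is the orthogonality that \<open>C(2)\<close> asks for; the value
      is the product of \<open>h\<close> with the rotated T, forced by the equal norms.\<close>
    have Zh: "cis (- real d * \<phi>) * val_at_i d h = of_real (- \<eta> / 2)"
    proof -
      have "val_at_i d h = Z - 2 ^ (d - 1) * cis (real d * \<phi>)"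
        unfolding val_at_i_rotated_T[OF d, symmetric]
        by (simp add: val_at_i_def h_def Z_def left_diff_distrib sum_subtractf)
      then have "cis (- real d * \<phi>) * val_at_i d h
        = of_real (cmod Z) - 2 ^ (d - 1) * (cis (- real d * \<phi>) * cis (real d * \<phi>))"
        by (simp only: right_diff_distrib Z mult.left_commute)
      then show ?thesis by (simp add: cis_mult \<eta>)
    qed
    have sum_s: "(\<Sum>k<d. s k) \<le> 0"
      unfolding s_def sum_alternating_circle_val[OF d] Zh using \<eta>0
      by (simp add: divide_le_0_iff mult_nonneg_nonneg)
    show "\<exists>t. (circle_val d a t)\<^sup>2 + (circle_deriv d a t)\<^sup>2 / real d \<le> 1"
    proof (rule ccontr)
      assume "\<not> ?thesis"
      then have large: "(circle_val d a t)\<^sup>2 + (circle_deriv d a t)\<^sup>2 / real d > 1" for t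
        by (auto simp: not_le)
      \<comment> \<open>At the sampled angles the rotated T is (-1)^k with derivative 0, so
        \<open>large\<close> expands to 1 + 2 \<open>s k\<close> plus terms that
        \<open>bessel\<close> bounds by \<open>\<eta>\<close>.\<close>
      have s_lower: "s k > - \<eta> / 2" for k
      proof -
        define t where "t = real k * pi / real d + \<phi>"
        have angle: "real d * (t - \<phi>) = real k * pi" using d by (simp add: t_def)
        have "circle_val d a t = circle_val d h t + circle_val d (rotated_T d \<phi>) t"
          "circle_deriv d a t = circle_deriv d h t + circle_deriv d (rotated_T d \<phi>) t"
          unfolding h_def coeff_inner_point_kernel[symmetric] coeff_inner_tangent_kernel[symmetric]
            coeff_inner_linear by simp_all
        then have val: "circle_val d a t = circle_val d h t + (- 1) ^ k"
          and der: "circle_deriv d a t = circle_deriv d h t"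
          by (simp_all add: circle_val_rotated_T circle_deriv_rotated_T angle)
        have s_k: "s k = (- 1) ^ k * circle_val d h t" by (simp only: s_def t_def)
        have sign: "((- 1 :: real) ^ k)\<^sup>2 = 1" by (simp flip: power_mult)
        have "1 < (circle_val d h t)\<^sup>2 + (circle_deriv d h t)\<^sup>2 / real d + 2 * s k + 1"
          using large[of t] unfolding val der power2_sum s_k sign by (simp add: algebra_simps)
        with bessel[OF d, of h t] show ?thesis by (simp add: \<eta>_def)
      qed
      \<comment> \<open>If \<open>\<eta>\<close> were 0, all \<open>s k\<close> would be positive,
        against \<open>sum_s\<close>.\<close>
      have "\<eta> \<noteq> 0"
      proof
        assume "\<eta> = 0"
        then have "(\<Sum>k<d. s k) > 0"
          using s_lower d by (intro sum_pos) auto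
        with sum_s show False by simp
      qed
      with \<eta>0 have \<eta>_pos: "\<eta> > 0" by simp
      \<comment> \<open>The sum of the \<open>s k\<close> is at most 0 and each term exceeds
        -\<open>\<eta>\<close>/2, so no single term can be large.\<close>
      have "\<bar>circle_val d h (real k * pi / real d + \<phi>)\<bar> \<le> real d * \<eta>" if k: "k < d" for k
      proof -
        have "- (real d * \<eta>) \<le> (\<Sum>j\<in>{..<d} - {k}. - \<eta>)"
          using \<eta>0 k by (simp add: mult_right_mono)
        also have "\<dots> \<le> (\<Sum>j\<in>{..<d} - {k}. s j)"
          using s_lower \<eta>0 by (intro sum_mono) (smt (verit) field_sum_of_halves)
        also have "\<dots> \<le> - s k"
          using sum_s k by (simp add: sum.remove[of "{..<d}" k])
        finally have "s k \<le> real d * \<eta>" by simp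
        moreover have "\<eta> / 2 \<le> real d * \<eta>"
          using \<eta>0 d mult_right_mono[of 1 "real d" \<eta>] by simp
        then have "- (real d * \<eta>) \<le> s k"
          using s_lower[of k] by simp
        moreover have "\<bar>s k\<bar> = \<bar>circle_val d h (real k * pi / real d + \<phi>)\<bar>"
          by (simp add: s_def abs_mult power_abs)
        ultimately show ?thesis by linarith
      qed
      \<comment> \<open>Samples of size d \<open>\<eta>\<close> control \<open>h\<close> linearly,
        which bounds its squared norm \<open>\<eta>\<close> by a multiple of
        \<open>\<eta>\<^sup>2\<close>.\<close>
      then have "\<eta> \<le> (C * (real d * \<eta>))\<^sup>2"
        unfolding \<eta>_def by (intro C(2)[of \<phi>]) (simp_all only: Zh Im_complex_of_real)
      also have "\<dots> = \<eta> * ((C * real d)\<^sup>2 * \<eta>)"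
        by (simp add: power2_eq_square)
      also have "\<dots> < \<eta> * ((C * real d)\<^sup>2 * (1 / (C * real d))\<^sup>2)"
        using \<eta>_less \<eta>_pos C(1) d by (intro mult_strict_left_mono) auto
      also have "\<dots> = \<eta>"
        using C(1) d by (simp add: power_divide)
      finally show False by simp
    qed
  qed
qed

theorem proposition8p4:
  fixes d :: nat
  assumes "d \<ge> 2"
  shows "T_form d \<in> forms d \<and>
    (\<exists>\<epsilon>>0. \<forall>P\<in>forms d.
      bombieri_norm d P = bombieri_norm d (T_form d) \<and> bombieri_norm d (P - T_form d) < \<epsilon> \<longrightarrow>
      dist_discriminant d P \<le> dist_discriminant d (T_form d))"
proof (intro conjI T_form_in_forms)
  have d: "d > 0" using assms by simp
  obtain \<epsilon> where \<epsilon>: "\<epsilon> > 0"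
    "\<And>a. coeff_inner d a a = 2 ^ (d - 1) \<Longrightarrow>
      coeff_inner d (\<lambda>i. a i - rotated_T d 0 i) (\<lambda>i. a i - rotated_T d 0 i) < \<epsilon>\<^sup>2 \<Longrightarrow>
      \<exists>t. (circle_val d a t)\<^sup>2 + (circle_deriv d a t)\<^sup>2 / real d \<le> 1"
    using near_T_small_value[OF d] by blast
  \<comment> \<open>At angle t the quantity for T is cos^2 (d t) + d sin^2 (d t).\<close>
  have T: "dist_discriminant d (T_form d) \<ge> 1"
  proof (rule dist_discriminant_ge[OF d T_form_in_forms])
    fix t
    have "(circle_val d (form_coeff d (T_form d)) t)\<^sup>2
        + (circle_deriv d (form_coeff d (T_form d)) t)\<^sup>2 / real d
      = (cos (real d * t))\<^sup>2 + real d * (sin (real d * t))\<^sup>2"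
      using d by (simp add: form_coeff_T_form circle_val_rotated_T circle_deriv_rotated_T
          power_mult_distrib power2_eq_square)
    also have "\<dots> \<ge> (cos (real d * t))\<^sup>2 + 1 * (sin (real d * t))\<^sup>2"
      using d by (intro add_left_mono mult_right_mono) auto
    finally show "1\<^sup>2 \<le> (circle_val d (form_coeff d (T_form d)) t)\<^sup>2
        + (circle_deriv d (form_coeff d (T_form d)) t)\<^sup>2 / real d"
      by simp
  qed
  have "dist_discriminant d P \<le> dist_discriminant d (T_form d)"
    if P: "P \<in> forms d" and norm: "bombieri_norm d P = bombieri_norm d (T_form d)"
      and near: "bombieri_norm d (P - T_form d) < \<epsilon>" for P
  proof -
    let ?a = "form_coeff d P"
    have "coeff_inner d ?a ?a = 2 ^ (d - 1)"
      using norm by (simp add: bombieri_norm_eq form_coeff_T_form coeff_inner_rotated_T_self[OF d])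
    moreover have "(bombieri_norm d (P - T_form d))\<^sup>2 < \<epsilon>\<^sup>2"
      using near bombieri_norm_nonneg by (intro power_strict_mono) auto
    then have "coeff_inner d (\<lambda>i. ?a i - rotated_T d 0 i) (\<lambda>i. ?a i - rotated_T d 0 i) < \<epsilon>\<^sup>2"
      by (simp add: bombieri_norm_eq form_coeff_diff form_coeff_T_form coeff_inner_nonneg)
    ultimately obtain t where "(circle_val d ?a t)\<^sup>2 + (circle_deriv d ?a t)\<^sup>2 / real d \<le> 1"
      using \<epsilon>(2) by blast
    then have "dist_discriminant d P \<le> 1"
      using dist_discriminant_le[OF d P, of t] by (smt (verit) real_sqrt_le_1_iff)
    with T show ?thesis by simp
  qed
  with \<epsilon>(1) show "\<exists>\<epsilon>>0. \<forall>P\<in>forms d.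
      bombieri_norm d P = bombieri_norm d (T_form d) \<and> bombieri_norm d (P - T_form d) < \<epsilon> \<longrightarrow>
      dist_discriminant d P \<le> dist_discriminant d (T_form d)"
    by blast
qed

end
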